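(* Fix $0<p<1$, put $q=1-p$, and let $H\subset\mathbb R$ be compact. For a positive integer $N$ and $h\in H$ such that $Np+h\in\{0,1,\dots,N\}$, let $$\pi_N(h;p)=\binom{N}{Np+h}\,p^{Np+h}\,q^{Nq-h}=\Pr\{X=Np+h\},\qquad X\sim\operatorname{Bin}(N,p).$$ Then, as $N\to\infty$, $$\pi_N(h;p)\sim\frac1{\sqrt{2\pi Npq}}\exp\Bigl(\sum_{k\ge1}\frac{A_k(h;p)}{N^k}\Bigr),$$ where, for $k\ge1$, $$A_k(h;p)=\frac{(-1)^{k+1}}{k(k+1)}\Bigl[B_{k+1}-\bigl(p^{-k}+(-1)^{k+1}q^{-k}\bigr)B_{k+1}(h)\Bigr]+\frac{(-1)^{k}h^{k}}{k\,p^{k}}.$$ Equivalently, in multiplicative form, $$\pi_N(h;p)\sim\frac1{\sqrt{2\pi Npq}}\sum_{m\ge0}\frac{c_m(h;p)}{N^m},\qquad c_0=1,\quad c_m(h;p)=\frac1m\sum_{k=1}^{m}k\,A_k(h;p)\,c_{m-k}(h;p)\quad(m\ge1).$$ For every $M\ge0$ the remainder after truncation at order $M$ is $O(N^{-M-1})$ relative to the leading factor, i.e. $$\pi_N(h;p)=\frac1{\sqrt{2\pi Npq}}\Bigl(\sum_{m=0}^{M}\frac{c_m(h;p)}{N^m}+O(N^{-M-1})\Bigr),$$ uniformly for all $h\in H$ with $Np+h\in\{0,1,\dots,N\}$, with an implied constant depending only on $M$, $p$ and $H$. If $p$ is restricted to a compact subinterval of $(0,1)$, the constants may be chosen uniformly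 in $p$.
   Context: $B_k(t)$ are the Bernoulli polynomials, $\frac{z e^{tz}}{e^z-1}=\sum_{k\ge0}B_k(t)\frac{z^k}{k!}$, and $B_k=B_k(0)$ the Bernoulli numbers (so $B_1=-\tfrac12$). $\operatorname{Bin}(N,p)$ is the binomial distribution. Convention on asymptotic expansions: $f(x)\sim g(x)\sum_{n\ge0}c_nx^{-n}$ means that for every fixed $M$, $f(x)=g(x)\bigl(\sum_{n=0}^{M}c_nx^{-n}+O(x^{-M-1})\bigr)$, with implied constant uniform in all parameters ranging over the specified compact sets. When an expansion is displayed as the exponential of a series, the logarithmic series is truncated at a fixed order and the exponential is re-expanded to the same order. The coefficients may depend on parameters (here $h$), which may vary with $N$. *)

theory Defs
  imports "HOL-Probability.Probability" "HOL-Computational_Algebra.Formal_Power_Series"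
begin

text \<open>The generating function is a quotient of formal power series; both numerator and
  denominator have zero constant term, which division of power series over a field
  cancels.\<close>

definition bernpoly :: "nat \<Rightarrow> real \<Rightarrow> real" where
  "bernpoly k t = fact k * fps_nth (fps_X * fps_exp t / (fps_exp 1 - 1)) k"

definition bernoulli :: "nat \<Rightarrow> real" where
  "bernoulli k = bernpoly k 0"

text \<open>Meaningful when \<open>N * p + h\<close> is one of the integers \<open>0, \<dots>, N\<close>; then the floor is exact.\<close>

definition binom_prob :: "nat \<Rightarrow> real \<Rightarrow> real \<Rightarrow> real" where
  "binom_prob N h p =
     real (N choose nat \<lfloor>real N * p + h\<rfloor>)
       * p powr (real N * p + h) * (1 - p) powr (real N * (1 - p) - h)"

definition A_coeff :: "nat \<Rightarrow> real \<Rightarrow> real \<Rightarrow> real" where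
  "A_coeff k h p =
     (- 1) ^ (k + 1) / (real k * (real k + 1))
       * (bernoulli (k + 1)
          - (1 / p ^ k + (- 1) ^ (k + 1) * (1 / (1 - p) ^ k)) * bernpoly (k + 1) h)
     + (- 1) ^ k * h ^ k / (real k * p ^ k)"

fun c_coeff :: "nat \<Rightarrow> real \<Rightarrow> real \<Rightarrow> real" where
  "c_coeff 0 h p = 1"
| "c_coeff (Suc m) h p =
     1 / real (Suc m) * (\<Sum>k = 1..Suc m. real k * A_coeff k h p * c_coeff (Suc m - k) h p)"

text \<open>\<open>f N y = g N y * (\<Sum>n\<le>M. c M n y / N ^ n + O(1 / N ^ (M + 1)))\<close> for every \<open>M\<close>, with the
  implied constant and the threshold for \<open>N\<close> uniform in the parameters \<open>y \<in> S N\<close>.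
  The coefficients may depend on the truncation order \<open>M\<close> because of
  \<open>exp_series_expansion\<close> below.\<close>

definition uniform_expansion ::
  "(nat \<Rightarrow> 'a \<Rightarrow> real) \<Rightarrow> (nat \<Rightarrow> 'a \<Rightarrow> real) \<Rightarrow> (nat \<Rightarrow> nat \<Rightarrow> 'a \<Rightarrow> real) \<Rightarrow> (nat \<Rightarrow> 'a set) \<Rightarrow> bool"
where
  "uniform_expansion f g c S \<longleftrightarrow>
     (\<forall>M. \<exists>C. \<forall>\<^sub>F N in sequentially. \<forall>y \<in> S N. \<exists>r.
        f N y = g N y * ((\<Sum>n\<le>M. c M n y / real N ^ n) + r) \<and> \<bar>r\<bar> \<le> C / real N ^ (M + 1))"

definition series_expansion ::
  "(nat \<Rightarrow> 'a \<Rightarrow> real) \<Rightarrow> (nat \<Rightarrow> 'a \<Rightarrow> real) \<Rightarrow> (nat \<Rightarrow> 'a \<Rightarrow> real) \<Rightarrow> (nat \<Rightarrow> 'a set) \<Rightarrow> bool"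
where
  "series_expansion f g c S \<longleftrightarrow> uniform_expansion f g (\<lambda>_. c) S"

text \<open>An expansion displayed as \<open>g * exp (\<Sum>k\<ge>1. A k / N ^ k)\<close>: the logarithmic series is
  truncated at order \<open>M\<close> and its exponential is re-expanded to the same order, as a formal
  power series in \<open>1 / N\<close>.\<close>

definition exp_series_expansion ::
  "(nat \<Rightarrow> 'a \<Rightarrow> real) \<Rightarrow> (nat \<Rightarrow> 'a \<Rightarrow> real) \<Rightarrow> (nat \<Rightarrow> 'a \<Rightarrow> real) \<Rightarrow> (nat \<Rightarrow> 'a set) \<Rightarrow> bool"
where
  "exp_series_expansion f g A S \<longleftrightarrow>
     uniform_expansion f g
       (\<lambda>M n y. fps_nth (fps_exp 1 oo (\<Sum>k = 1..M. fps_const (A k y) * fps_X ^ k)) n) S"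

definition admissible :: "real set \<Rightarrow> real set \<Rightarrow> nat \<Rightarrow> (real \<times> real) set" where
  "admissible H P N = {(h, p). h \<in> H \<and> p \<in> P \<and> (\<exists>j\<in>{0..N}. real N * p + h = real j)}"

definition leading_factor :: "nat \<Rightarrow> real \<Rightarrow> real" where
  "leading_factor N p = 1 / sqrt (2 * pi * real N * p * (1 - p))"

end

theory Submission
  imports Defs
begin

text \<open>The truncated logarithmic Stirling series \<open>S\<^sub>M(x, a)\<close> for \<open>ln \<Gamma>(x + a)\<close> should depend on
  \<open>x + a\<close> only. Since \<open>B'\<^sub>k\<^sub>+\<^sub>1 = (k + 1) B\<^sub>k\<close>, its derivative along \<open>x + a = const\<close> telescopes to the
  single term \<open>(-1)^M B\<^sub>M\<^sub>+\<^sub>1(a) / ((M + 1) x^(M + 1))\<close>, so \<open>S\<^sub>M(x + t, a - t)\<close> and \<open>S\<^sub>M(x, a)\<close>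
  differ by \<open>O(x^-(M + 1))\<close> for bounded \<open>t\<close> and \<open>a\<close>. Together with
  \<open>S\<^sub>M(x, a + 1) = S\<^sub>M(x, a) + ln (x + a) + O(x^-(M + 1))\<close> this shows that the increments of
  \<open>ln n! - S\<^sub>M(n, 1)\<close> are small; the limit is \<open>0\<close> by Wallis' product. The same shift turns
  \<open>ln (Np + h)!\<close> into an expansion in powers of \<open>1 / N\<close>, uniformly in \<open>h\<close> and \<open>p\<close>.

  To exponentiate, let \<open>L\<close> be the truncated logarithmic series in \<open>u = 1 / N\<close> and
  \<open>P = (\<Sum>m\<le>M. c\<^sub>m u^m)\<close>. The recurrence for \<open>c\<^sub>m\<close> cancels all coefficients of \<open>P' - L' P\<close> below order
  \<open>M\<close>, so that \<open>P exp (-L) - 1 = O(u^(M + 1))\<close> by the mean value theorem.\<close>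

subsection \<open>Bernoulli polynomials\<close>

definition bern_gf :: "real \<Rightarrow> real fps" where
  "bern_gf t = fps_X * fps_exp t / (fps_exp 1 - 1)"

lemma bernpoly_bern_gf: "bernpoly k t = fact k * fps_nth (bern_gf t) k"
  by (simp add: bernpoly_def bern_gf_def)

text \<open>Numerator and denominator share a factor \<open>fps_X\<close>; cancelling it leaves the
  unit \<open>U\<close> below, and \<open>V\<close> is its inverse. All dependence on
  \<open>t\<close> then sits in \<open>fps_exp t\<close>.\<close>

lemma bern_gf_eq_mult:
  "\<exists>V. fps_nth V 0 = 1 \<and> V * (fps_exp 1 - 1) = fps_X \<and> (\<forall>t. bern_gf t = fps_exp t * V)"
proof -
  define U :: "real fps" where "U = fps_shift 1 (fps_exp 1 - 1)"
  have U: "fps_exp 1 - 1 = fps_X * U"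
    by (rule fps_ext) (auto simp: U_def)
  have U0: "fps_nth U 0 = 1"
    by (simp add: U_def)
  have "bern_gf t = fps_exp t * inverse U" for t
    using U0 by (simp add: bern_gf_def U fps_divide_unit)
  moreover have "inverse U * (fps_exp 1 - 1) = fps_X"
    using U0 inverse_mult_eq_1[of U] by (simp add: U mult.left_commute)
  ultimately show ?thesis
    using U0 by (intro exI[of _ "inverse U"]) simp
qed

lemma bern_gf_mult: "bern_gf t * (fps_exp 1 - 1) = fps_X * fps_exp t"
proof -
  obtain V where "V * (fps_exp 1 - 1) = fps_X" "bern_gf t = fps_exp t * V"
    using bern_gf_eq_mult by auto
  thus ?thesis
    by (metis mult.assoc mult.commute)
qed

text \<open>Power series over a field have no zero divisors, so the multiplied-out equation
  determines the quotient; this identifies the reflected series below.\<close>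

lemma bern_gf_unique:
  assumes "F * (fps_exp 1 - 1) = fps_X * fps_exp t"
  shows "F = bern_gf t"
  proof -
  have "fps_exp 1 - 1 \<noteq> (0 :: real fps)"
    by simp
  thus ?thesis
    using assms bern_gf_mult[of t] by (metis mult_right_cancel)
qed

text \<open>Multiplication by \<open>fps_exp 1\<close> shifts \<open>t\<close> by one; writing it as
  \<open>1 + (fps_exp 1 - 1)\<close> brings in the defining equation.\<close>

lemma bern_gf_plus_1: "bern_gf (t + 1) = bern_gf t + fps_X * fps_exp t"
proof -
  have "bern_gf (t + 1) = bern_gf t * fps_exp 1"
    using bern_gf_eq_mult by (auto simp: fps_exp_add_mult mult_ac)
  thus ?thesis
    using bern_gf_mult[of t] by (simp add: algebra_simps)
qed

text \<open>Substitute \<open>-z\<close> for \<open>z\<close> in the defining equation and multiply by \<open>exp z\<close>.\<close>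

lemma bern_gf_reflect: "bern_gf (1 - t) = bern_gf t oo (- fps_X)"
proof (rule bern_gf_unique[symmetric])
  have "(bern_gf t * (fps_exp 1 - 1)) oo (- fps_X) = (fps_X * fps_exp t) oo (- fps_X)"
    by (simp only: bern_gf_mult)
  hence "(bern_gf t oo (- fps_X)) * (fps_exp (- 1) - 1) = - fps_X * fps_exp (- t)"
    by (simp add: fps_compose_mult_distrib fps_compose_sub_distrib)
  hence "(bern_gf t oo (- fps_X)) * (fps_exp (- 1) - 1) * fps_exp 1 = - fps_X * fps_exp (- t) * fps_exp 1"
    by simp
  moreover have "(fps_exp (- 1) - 1) * fps_exp 1 = (1 - fps_exp 1 :: real fps)"
    using fps_exp_add_mult[of "-1::real" 1] by (simp add: algebra_simps)
  moreover have "fps_exp (- t) * fps_exp 1 = fps_exp (1 - t)"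
    using fps_exp_add_mult[of "-t" 1] by simp
  ultimately have "(bern_gf t oo (- fps_X)) * (1 - fps_exp 1) = - fps_X * fps_exp (1 - t)"
    by (simp add: mult.assoc)
  thus "(bern_gf t oo (- fps_X)) * (fps_exp 1 - 1) = fps_X * fps_exp (1 - t)"
    by (simp add: algebra_simps)
qed

lemma bernpoly_plus_1: "bernpoly (Suc k) (t + 1) = bernpoly (Suc k) t + real (Suc k) * t ^ k"
proof -
  have "fact (Suc k) * fps_nth (fps_X * fps_exp t) (Suc k) = real (Suc k) * t ^ k"
    by (simp add: fact_Suc)
  thus ?thesis
    unfolding bernpoly_bern_gf bern_gf_plus_1 fps_add_nth distrib_left by simp
qed

lemma bernpoly_reflect: "bernpoly k (1 - t) = (- 1) ^ k * bernpoly k t"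
  by (simp add: bernpoly_bern_gf bern_gf_reflect fps_compose_uminus')

lemma bernpoly_0 [simp]: "bernpoly 0 t = 1"
  using bern_gf_eq_mult by (auto simp: bernpoly_bern_gf fps_mult_nth)

text \<open>Since \<open>V\<close> does not depend on \<open>t\<close>, each coefficient is a
  polynomial in \<open>t\<close> with terms \<open>t ^ i / fact i\<close>, on which differentiation
  acts as an index shift.\<close>

lemma bernpoly_has_real_derivative:
  "(bernpoly (Suc k) has_real_derivative (real (Suc k) * bernpoly k t)) (at t)"
proof -
  obtain V where V: "\<And>t. bern_gf t = fps_exp t * V"
    using bern_gf_eq_mult by auto
  have eq: "bernpoly n = (\<lambda>t. fact n * (\<Sum>i=0..n. t ^ i / fact i * fps_nth V (n - i)))" for n
    by (simp add: fun_eq_iff bernpoly_bern_gf V fps_mult_nth)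
  \<comment> \<open>The term \<open>i = 0\<close> vanishes through its factor \<open>real i\<close>,
    so the truncated subtraction in \<open>i - 1\<close> is harmless.\<close>
  have sum_eq: "(\<Sum>i=0..Suc k. real i * t ^ (i - 1) / fact i * fps_nth V (Suc k - i)) =
        (\<Sum>i=0..k. t ^ i / fact i * fps_nth V (k - i))"
    by (subst sum.atLeast0_atMost_Suc_shift)
       (auto simp: fact_Suc simp del: of_nat_Suc intro!: sum.cong)
  have "((\<lambda>t. t ^ i / fact i * fps_nth V (Suc k - i)) has_real_derivative
          (real i * t ^ (i - 1) / fact i * fps_nth V (Suc k - i))) (at t)" for i
    by (auto intro!: derivative_eq_intros)
  from DERIV_sum[OF this]
  have "((\<lambda>t. \<Sum>i=0..Suc k. t ^ i / fact i * fps_nth V (Suc k - i)) has_real_derivative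
          (\<Sum>i=0..k. t ^ i / fact i * fps_nth V (k - i))) (at t)"
    unfolding sum_eq[symmetric] .
  from DERIV_cmult[OF this, of "fact (Suc k)"] show ?thesis
    unfolding eq fact_Suc by (simp only: mult.assoc of_nat_mult of_nat_fact)
qed

text \<open>The derivative fixes the polynomial up to a constant, and reflection forces a zero at
  1/2.\<close>

lemma bernpoly_1: "bernpoly 1 t = t - 1 / 2"
proof -
  have "((\<lambda>t. bernpoly 1 t - t) has_real_derivative 0) (at x)" for x
    using bernpoly_has_real_derivative[of 0 x] by (auto intro!: derivative_eq_intros)
  hence "bernpoly 1 t - t = bernpoly 1 (1/2) - 1/2"
    using DERIV_isconst_all by blast
  moreover have "bernpoly 1 (1/2) = 0"
    using bernpoly_reflect[of 1 "1/2"] by simp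
  ultimately show ?thesis by simp
qed

lemma continuous_on_bernpoly [continuous_intros]:
  assumes "continuous_on A f"
  shows "continuous_on A (\<lambda>x. bernpoly k (f x))"
proof -
  have "continuous_on UNIV (bernpoly k)"
  proof (cases k)
    case 0
    thus ?thesis by (simp cong: continuous_on_cong)
  next
    case (Suc n)
    show ?thesis
      unfolding Suc by (rule DERIV_continuous_on)
        (rule has_field_derivative_at_within[OF bernpoly_has_real_derivative])
  qed
  from continuous_on_compose2[OF this assms] show ?thesis by simp
qed

subsection \<open>Stirling's series for factorials\<close>

text \<open>The series \<open>S_M(x, a)\<close> from above, truncating the expansion of ln Gamma(x +
  a) for large \<open>x\<close>; \<open>x = n\<close>, \<open>a = 1\<close> approximates
  \<open>ln (fact n)\<close>.\<close>

definition stirling_log :: "nat \<Rightarrow> real \<Rightarrow> real \<Rightarrow> real" where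
  "stirling_log M x a = (x + a - 1 / 2) * ln x - x + ln (2 * pi) / 2
     + (\<Sum>k = 1..M. (- 1) ^ (k + 1) * bernpoly (k + 1) a / (real k * (real k + 1) * x ^ k))"

lemma stirling_log_Suc:
  "stirling_log (Suc M) x a = stirling_log M x a
     + (- 1) ^ M * bernpoly (M + 2) a / ((real M + 1) * (real M + 2) * x ^ (M + 1))"
  by (simp add: stirling_log_def mult_ac add_ac)

lemma stirling_log_along_diagonal:
  assumes "x + t > 0"
  shows "((\<lambda>t. stirling_log M (x + t) (a - t)) has_real_derivative
           ((- 1) ^ M * bernpoly (M + 1) (a - t) / ((real M + 1) * (x + t) ^ (M + 1)))) (at t)"
proof (induction M)
  case 0
  \<comment> \<open>The sum of the two arguments stays \<open>x + a\<close>, so the coefficient of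
    the logarithm is constant; what remains is B_1(a - t) / (x + t).\<close>
  have "((\<lambda>t. (x + a - 1 / 2) * ln (x + t) - (x + t) + ln (2 * pi) / 2) has_real_derivative
          (x + a - 1 / 2) * (1 / (x + t)) - 1) (at t)"
    using assms by (auto intro!: derivative_eq_intros)
  also have "(x + a - 1 / 2) * (1 / (x + t)) - 1 = (a - t - 1 / 2) / (x + t)"
    using assms by (simp add: field_simps)
  finally show ?case
    by (simp add: stirling_log_def bernpoly_1[simplified])
next
  case (Suc M)
  define y where "y = x + t"
  define b1 where "b1 = bernpoly (M + 1) (a - t)"
  define b2 where "b2 = bernpoly (M + 2) (a - t)"
  have y: "y > 0" using assms by (simp add: y_def)
  have b: "((\<lambda>t. bernpoly (M + 2) (a - t)) has_real_derivative - (real M + 2) * b1) (at t)"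
  proof -
    have "((\<lambda>t. a - t) has_real_derivative - 1) (at t)"
      by (auto intro!: derivative_eq_intros)
    from DERIV_chain2[where g = "\<lambda>t. a - t", OF bernpoly_has_real_derivative[of "M + 1" "a - t"] this]
    show ?thesis by (simp add: b1_def algebra_simps)
  qed
  have p: "((\<lambda>t. (real M + 1) * (real M + 2) * (x + t) ^ (M + 1)) has_real_derivative
            (real M + 1) * (real M + 2) * ((real M + 1) * y ^ M)) (at t)"
  proof (rule DERIV_cmult)
    have "((\<lambda>t. x + t) has_real_derivative 1) (at t)"
      by (auto intro!: derivative_eq_intros)
    from DERIV_power[OF this, of "M + 1"]
    show "((\<lambda>t. (x + t) ^ (M + 1)) has_real_derivative (real M + 1) * y ^ M) (at t)"
      by (simp add: y_def add.commute)
  qed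
  have "((\<lambda>t. (- 1) ^ M * (bernpoly (M + 2) (a - t) / ((real M + 1) * (real M + 2) * (x + t) ^ (M + 1))))
     has_real_derivative
        (- 1) ^ M * ((- (real M + 2) * b1 * ((real M + 1) * (real M + 2) * y ^ (M + 1)) -
         b2 * ((real M + 1) * (real M + 2) * ((real M + 1) * y ^ M))) /
         (((real M + 1) * (real M + 2) * y ^ (M + 1)) * ((real M + 1) * (real M + 2) * y ^ (M + 1))))) (at t)"
    (is "(?f has_real_derivative _ * ?d) _")
    unfolding b2_def y_def using y
    by (intro DERIV_cmult DERIV_divide b p[unfolded y_def]) (auto simp: y_def)
  \<comment> \<open>Differentiating the Bernoulli polynomial gives the \<open>b1\<close> term, which
    cancels the induction hypothesis; differentiating the power gives the \<open>b2\<close> term,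
    the new remainder.\<close>
  also have "?d = - b1 / ((real M + 1) * y ^ (M + 1)) - b2 / ((real M + 2) * y ^ (M + 2))"
  proof -
    have "(- s * b1 * (r * s * (y * z)) - b2 * (r * s * (r * z))) / ((r * s * (y * z)) * (r * s * (y * z)))
        = - b1 / (r * (y * z)) - b2 / (s * (y * (y * z)))"
      if "r > 0" "s > 0" "z > 0" for r s z :: real
      using that y by (simp add: field_simps)
    from this[of "real M + 1" "real M + 2" "y ^ M"] y show ?thesis by simp
  qed
  finally have "(?f has_real_derivative (- 1) ^ M *
      (- b1 / ((real M + 1) * y ^ (M + 1)) - b2 / ((real M + 2) * y ^ (M + 2)))) (at t)" .
  from DERIV_add[OF Suc.IH this] show ?case
    unfolding stirling_log_Suc
    by (simp add: b1_def b2_def y_def algebra_simps)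
qed

lemma bernpoly_bounded: "\<exists>K. \<forall>s. \<bar>s\<bar> \<le> B \<longrightarrow> \<bar>bernpoly k s\<bar> \<le> K"
proof -
  have "compact (bernpoly k ` {-B..B})"
    by (intro compact_continuous_image continuous_on_bernpoly continuous_on_id compact_Icc)
  then obtain K where "\<forall>y \<in> bernpoly k ` {-B..B}. norm y \<le> K"
    using compact_imp_bounded bounded_iff by metis
  hence "\<bar>bernpoly k s\<bar> \<le> K" if "\<bar>s\<bar> \<le> B" for s
    using that by (simp add: abs_le_iff)
  thus ?thesis by blast
qed

text \<open>Mean value inequality along the diagonal. The condition on \<open>x / 2\<close> keeps
  \<open>x + s\<close> at least \<open>x / 2\<close> on the whole segment, at the cost of a factor
  \<open>2 ^ (M + 1)\<close>.\<close>

lemma stirling_log_shift: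
  "\<exists>C. \<forall>x t a. 0 < x \<and> x / 2 \<le> x + t \<and> \<bar>t\<bar> \<le> B \<and> \<bar>a\<bar> \<le> B \<longrightarrow>
     \<bar>stirling_log M (x + t) (a - t) - stirling_log M x a\<bar> \<le> C / x ^ (M + 1)"
proof -
  \<comment> \<open>The argument \<open>a - s\<close> ranges up to \<open>2 * B\<close> in absolute
    value.\<close>
  obtain K where K: "\<And>s. \<bar>s\<bar> \<le> 2 * B \<Longrightarrow> \<bar>bernpoly (M + 1) s\<bar> \<le> K"
    using bernpoly_bounded by blast
  have "\<bar>stirling_log M (x + t) (a - t) - stirling_log M x a\<bar> \<le> (K * 2 ^ (M + 1) * B) / x ^ (M + 1)"
    if x: "0 < x" "x / 2 \<le> x + t" and t: "\<bar>t\<bar> \<le> B" and a: "\<bar>a\<bar> \<le> B" for x t a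
  proof -
    let ?f' = "\<lambda>s. (- 1) ^ M * bernpoly (M + 1) (a - s) / ((real M + 1) * (x + s) ^ (M + 1))"
    have seg: "\<bar>s\<bar> \<le> \<bar>t\<bar> \<and> x / 2 \<le> x + s" if "s \<in> closed_segment 0 t" for s
      using that x by (auto simp: closed_segment_eq_real_ivl split: if_splits)
    have K0: "K \<ge> 0"
      using K[of 0] t by (auto intro: order.trans[OF abs_ge_zero])
    have "norm (stirling_log M (x + t) (a - t) - stirling_log M (x + 0) (a - 0))
            \<le> (K * 2 ^ (M + 1) / x ^ (M + 1)) * norm (t - 0)"
    proof (rule field_differentiable_bound[where f' = ?f' and S = "closed_segment 0 t"])
      fix s assume s: "s \<in> closed_segment 0 t"
      hence s': "x + s > 0" "\<bar>s\<bar> \<le> B" "x / 2 \<le> x + s"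
        using seg[OF s] x t by auto
      show "((\<lambda>s. stirling_log M (x + s) (a - s)) has_field_derivative ?f' s) (at s within closed_segment 0 t)"
        using stirling_log_along_diagonal[OF s'(1)] has_field_derivative_at_within by blast
      have "(x / 2) ^ (M + 1) \<le> (x + s) ^ (M + 1)"
        using s' x by (intro power_mono) auto
      also have "\<dots> \<le> (real M + 1) * (x + s) ^ (M + 1)"
        using mult_right_mono[of 1 "real M + 1" "(x + s) ^ (M + 1)"] s' by simp
      finally have le: "(x / 2) ^ (M + 1) \<le> (real M + 1) * (x + s) ^ (M + 1)" .
      have "norm (?f' s) \<le> K / (x / 2) ^ (M + 1)"
      proof -
        have "\<bar>bernpoly (M + 1) (a - s)\<bar> \<le> K"
          using s' a by (intro K) linarith
        hence "\<bar>bernpoly (M + 1) (a - s)\<bar> / ((real M + 1) * (x + s) ^ (M + 1)) \<le> K / (x / 2) ^ (M + 1)"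
          using le x K0 by (intro frac_le) auto
        thus ?thesis
          using s' by (simp add: abs_mult power_abs)
      qed
      thus "norm (?f' s) \<le> K * 2 ^ (M + 1) / x ^ (M + 1)"
        by (simp add: power_divide)
    qed auto
    also have "\<dots> \<le> (K * 2 ^ (M + 1) / x ^ (M + 1)) * B"
      using K0 x t by (intro mult_left_mono) auto
    finally show ?thesis by simp
  qed
  thus ?thesis by blast
qed

text \<open>The counterpart of ln Gamma(x + a + 1) = ln Gamma(x + a) + ln (x + a): the difference
  equation of the Bernoulli polynomials contributes the Taylor polynomial of ln (1 + a / x).\<close>

lemma stirling_log_plus_1:
  "stirling_log M x (a + 1) = stirling_log M x a + ln x
     + (\<Sum>k = 1..M. (- 1) ^ (k + 1) * a ^ k / (real k * x ^ k))"
proof -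
  have "(- 1) ^ (k + 1) * bernpoly (k + 1) (a + 1) / (real k * (real k + 1) * x ^ k)
       = (- 1) ^ (k + 1) * bernpoly (k + 1) a / (real k * (real k + 1) * x ^ k)
         + (- 1) ^ (k + 1) * a ^ k / (real k * x ^ k)" for k
  proof -
    have "(- 1) ^ (k + 1) * bernpoly (k + 1) (a + 1) / (real k * (real k + 1) * x ^ k)
        = (- 1) ^ (k + 1) * bernpoly (k + 1) a / (real k * (real k + 1) * x ^ k)
          + (real k + 1) * ((- 1) ^ (k + 1) * a ^ k) / ((real k + 1) * (real k * x ^ k))"
    proof -
      have "bernpoly (k + 1) (a + 1) = bernpoly (k + 1) a + (real k + 1) * a ^ k"
        using bernpoly_plus_1[of k a] by (simp add: add.commute)
      thus ?thesis
        by (simp only: distrib_left[of "(- 1) ^ (k + 1)"] add_divide_distrib mult.left_commute mult.assoc mult.commute)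
    qed
    thus ?thesis by (simp only: mult_divide_mult_cancel_left)
  qed
  thus ?thesis
    unfolding stirling_log_def by (simp only: sum.distrib) (simp add: algebra_simps)
qed

section \<open>Remainder and constant in Stirling's series\<close>

lemma ln_1_plus_taylor:
  assumes "u \<ge> (0::real)"
  shows "\<bar>ln (1 + u) - (\<Sum>k = 1..M. (- 1) ^ (k + 1) * u ^ k / real k)\<bar> \<le> u ^ (M + 1)"
proof -
  let ?f = "\<lambda>v. ln (1 + v) - (\<Sum>k = 1..M. (- 1) ^ (k + 1) * v ^ k / real k)"
  \<comment> \<open>The derivative of the remainder is the tail of the geometric series for 1 / (1 +
    v); each further Taylor term removes one term from that tail.\<close>
  have D: "(?f has_real_derivative (- v) ^ M / (1 + v)) (at v)" if "v \<ge> 0" for v :: real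
  proof (induction M)
    case 0
    show ?case using that by (auto intro!: derivative_eq_intros simp: field_simps)
  next
    case (Suc M)
    have "((\<lambda>v. (- 1) ^ M * v ^ Suc M / real (Suc M)) has_real_derivative (- 1) ^ M * v ^ M) (at v)"
      using DERIV_cdivide[OF DERIV_cmult[OF DERIV_pow[of "Suc M" v]], of "(- 1) ^ M" "real (Suc M)"]
      by (simp add: mult.left_commute del: of_nat_Suc)
    from DERIV_diff[OF Suc.IH this]
    have "((\<lambda>v. ln (1 + v) - (\<Sum>k = 1..M. (- 1) ^ (k + 1) * v ^ k / real k)
              - (- 1) ^ M * v ^ Suc M / real (Suc M)) has_real_derivative
           ((- v) ^ M / (1 + v) - (- 1) ^ M * v ^ M)) (at v)" .
    moreover have "(- v) ^ M / (1 + v) - (- 1) ^ M * v ^ M = (- v) ^ Suc M / (1 + v)"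
      using that by (simp add: divide_simps power_minus[of v]) (simp add: algebra_simps)
    moreover have "ln (1 + v) - (\<Sum>k = 1..Suc M. (- 1) ^ (k + 1) * v ^ k / real k)
        = ln (1 + v) - (\<Sum>k = 1..M. (- 1) ^ (k + 1) * v ^ k / real k)
            - (- 1) ^ M * v ^ Suc M / real (Suc M)" for v
      by (subst sum.cl_ivl_Suc) (simp del: of_nat_Suc)
    ultimately show ?case by (simp only:)
  qed
  have "norm (?f u - ?f 0) \<le> u ^ M * norm (u - 0)"
  proof (rule field_differentiable_bound[where S = "{0..u}" and f' = "\<lambda>v. (- v) ^ M / (1 + v)"])
    fix v assume v: "v \<in> {0..u}"
    show "(?f has_field_derivative (- v) ^ M / (1 + v)) (at v within {0..u})"
      by (rule has_field_derivative_at_within[OF D]) (use v in auto)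
    have "v ^ M / (1 + v) \<le> v ^ M / 1"
      using v by (intro divide_left_mono) auto
    also have "\<dots> \<le> u ^ M" using v by (auto intro: power_mono)
    finally show "norm ((- v) ^ M / (1 + v)) \<le> u ^ M"
      using v by (simp add: norm_power power_abs)
  qed (use assms in auto)
  moreover have "(\<Sum>k = 1..M. (- 1) ^ (k + 1) * 0 ^ k / real k) = (0::real)"
    by (intro sum.neutral) auto
  ultimately show ?thesis using assms by (simp add: mult.commute)
qed

text \<open>The increments are dominated by differences of \<open>1 / real n ^ (m + 1)\<close>,
  which telescope. This gives the Cauchy property, and letting the upper index tend to infinity
  gives the rate.\<close>

lemma telescoping_limit:
  fixes R :: "nat \<Rightarrow> real"
  assumes step: "\<And>n. n \<ge> 1 \<Longrightarrow> \<bar>R (Suc n) - R n\<bar> \<le> D / real n ^ (m + 2)"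
  shows "\<exists>L. R \<longlonglongrightarrow> L \<and> (\<forall>n\<ge>1. \<bar>R n - L\<bar> \<le> 2 ^ (m + 1) * D / real n ^ (m + 1))"
proof -
  define E where "E = 2 ^ (m + 1) * D"
  have D: "D \<ge> 0" using step[of 1] by (simp add: order.trans[OF abs_ge_zero])
  hence E: "E \<ge> 0" by (simp add: E_def)
  \<comment> \<open>The factor \<open>2 ^ (m + 1)\<close> comes from bounding n + 1 by 2n in the
    denominator of the difference.\<close>
  have diff: "1 / real n ^ (m + 2) \<le> 2 ^ (m + 1) * (1 / real n ^ (m + 1) - 1 / real (Suc n) ^ (m + 1))"
    if n: "n \<ge> 1" for n
  proof -
    let ?x = "real n"
    have x: "?x \<ge> 1" using n by simp
    have "(?x + 1) * ?x ^ m \<le> (?x + 1) * (?x + 1) ^ m"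
      by (intro mult_left_mono power_mono) auto
    hence 1: "?x ^ m \<le> (?x + 1) ^ (m + 1) - ?x ^ (m + 1)"
      by (simp add: algebra_simps)
    have "(?x + 1) ^ (m + 1) \<le> (2 * ?x) ^ (m + 1)"
      using x by (intro power_mono) auto
    hence 2: "(?x + 1) ^ (m + 1) \<le> 2 ^ (m + 1) * ?x ^ (m + 1)"
      by (simp only: power_mult_distrib)
    have "1 / ?x ^ (m + 2) = 2 ^ (m + 1) * (?x ^ m / (?x ^ (m + 1) * (2 ^ (m + 1) * ?x ^ (m + 1))))"
      using x by (simp add: field_simps)
    also have "\<dots> \<le> 2 ^ (m + 1) * (((?x + 1) ^ (m + 1) - ?x ^ (m + 1)) / (?x ^ (m + 1) * (?x + 1) ^ (m + 1)))"
      using 1 2 x by (intro mult_left_mono frac_le) (auto simp: power_mono simp del: power_Suc)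
    also have "((?x + 1) ^ (m + 1) - ?x ^ (m + 1)) / (?x ^ (m + 1) * (?x + 1) ^ (m + 1))
                = 1 / ?x ^ (m + 1) - 1 / (?x + 1) ^ (m + 1)"
      using x by (simp add: diff_divide_distrib)
    finally show ?thesis by (simp add: add.commute)
  qed
  have bound: "\<bar>R (n + j) - R n\<bar> \<le> E * (1 / real n ^ (m + 1) - 1 / real (n + j) ^ (m + 1))"
    if n: "n \<ge> 1" for n j
  proof (induction j)
    case (Suc j)
    have "\<bar>R (Suc (n + j)) - R (n + j)\<bar> \<le> D * (1 / real (n + j) ^ (m + 2))"
      using step[of "n + j"] n by simp
    also have "\<dots> \<le> D * (2 ^ (m + 1) * (1 / real (n + j) ^ (m + 1) - 1 / real (Suc (n + j)) ^ (m + 1)))"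
      using diff[of "n + j"] n D by (intro mult_left_mono) auto
    also have "\<dots> = E * (1 / real (n + j) ^ (m + 1) - 1 / real (Suc (n + j)) ^ (m + 1))"
      by (simp add: E_def)
    finally have "\<bar>R (Suc (n + j)) - R (n + j)\<bar> \<le> \<dots>" .
    with Suc show ?case unfolding right_diff_distrib add_Suc_right by linarith
  qed simp
  have bound': "\<bar>R k - R n\<bar> \<le> E / real n ^ (m + 1)" if "n \<ge> 1" "k \<ge> n" for n k
  proof -
    have "\<bar>R k - R n\<bar> \<le> E * (1 / real n ^ (m + 1) - 1 / real k ^ (m + 1))"
      using bound[of n "k - n"] that by simp
    also have "\<dots> \<le> E * (1 / real n ^ (m + 1))"
      using E by (intro mult_left_mono) auto
    finally show ?thesis by simp
  qed
  have "Cauchy R"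
  proof (rule CauchyI')
    fix e :: real assume e: "e > 0"
    obtain N :: nat where N: "real N > E / e" using reals_Archimedean2 by blast
    have "\<bar>R n - R k\<bar> < e" if "n \<ge> Suc N" "k > n" for n k
    proof -
      have "E < e * real n"
      proof -
        have "E < e * real N" using N e by (simp add: field_simps)
        also have "\<dots> \<le> e * real n" using that e by simp
        finally show ?thesis .
      qed
      hence "E / real n < e" using that by (simp add: field_simps)
      moreover have "real n ^ 1 \<le> real n ^ (m + 1)" using that by (intro power_increasing) auto
      hence "E / real n ^ (m + 1) \<le> E / real n"
        using that E by (intro divide_left_mono) auto
      ultimately show ?thesis using bound'[of n k] that by (simp add: abs_minus_commute)
    qed
    thus "\<exists>M. \<forall>n\<ge>M. \<forall>k>n. dist (R n) (R k) < e" by (auto simp: dist_real_def)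
  qed
  then obtain L where L: "R \<longlonglongrightarrow> L" using Cauchy_convergent_iff convergent_def by blast
  have "\<bar>R n - L\<bar> \<le> E / real n ^ (m + 1)" if n: "n \<ge> 1" for n
  proof (rule tendsto_le[OF sequentially_bot tendsto_const])
    show "(\<lambda>k. \<bar>R n - R k\<bar>) \<longlonglongrightarrow> \<bar>R n - L\<bar>" by (intro tendsto_intros L)
    show "\<forall>\<^sub>F k in sequentially. \<bar>R n - R k\<bar> \<le> E / real n ^ (m + 1)"
      using bound'[OF n] by (auto simp: eventually_sequentially abs_minus_commute)
  qed
  with L show ?thesis unfolding E_def by blast
qed

text \<open>The odd factors 2k - 1 and 2k + 1 are expressed through \<open>fact (2 * n)\<close>, so
  that the logarithm of the product involves only factorials at n and 2n.\<close>

lemma wallis_product_eq: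
  "(\<Prod>k=1..n. (4*real k^2) / (4*real k^2 - 1)) =
     2 ^ (4 * n) * fact n ^ 4 / (fact (2 * n) ^ 2 * (2 * real n + 1))"
proof (induction n)
  case (Suc n)
  have 1: "4 * real (Suc n) ^ 2 - 1 = (2 * real n + 1) * (2 * real n + 3)"
    by (simp add: algebra_simps power2_eq_square)
  have 2: "fact (2 * Suc n) = (2 * real n + 2) * (2 * real n + 1) * fact (2 * n)"
    by (simp add: algebra_simps)
  have 3: "fact (Suc n) = (real n + 1) * fact n" by simp
  have "(\<Prod>k=1..Suc n. (4*real k^2) / (4*real k^2 - 1)) =
     2 ^ (4 * n) * fact n ^ 4 / (fact (2 * n) ^ 2 * (2 * real n + 1)) *
       (4 * real (Suc n) ^ 2 / ((2 * real n + 1) * (2 * real n + 3)))"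
    by (subst prod.cl_ivl_Suc) (simp only: Suc.IH 1, simp)
  also have "\<dots> = 2 ^ (4 * Suc n) * fact (Suc n) ^ 4 / (fact (2 * Suc n) ^ 2 * (2 * real (Suc n) + 1))"
  proof -
    \<comment> \<open>Abstract reals replace the power and the factorials, so that simplification
      does not unfold them; the common factor \<open>4 * (r + 1) ^ 2\<close> is then
      cancelled.\<close>
    have "A * F ^ 4 / (G ^ 2 * (2 * r + 1)) * (4 * (r + 1) ^ 2 / ((2 * r + 1) * (2 * r + 3)))
        = 16 * A * ((r + 1) * F) ^ 4 / (((2 * r + 2) * (2 * r + 1) * G) ^ 2 * (2 * r + 3))"
      if "r \<ge> 0" for A F G r :: real
    proof -
      have "16 * A * ((r + 1) * F) ^ 4 = (4 * (r + 1) ^ 2) * (4 * (r + 1) ^ 2 * A * F ^ 4)"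
        unfolding power_mult_distrib by (simp add: mult_ac flip: power_add)
      moreover have "((2 * r + 2) * (2 * r + 1) * G) ^ 2 * (2 * r + 3)
                       = (4 * (r + 1) ^ 2) * (G ^ 2 * (2 * r + 1) ^ 2 * (2 * r + 3))"
        using power_mult_distrib[of 2 "r + 1" 2] by (simp add: power_mult_distrib mult_ac)
      moreover have "4 * (r + 1) ^ 2 \<noteq> 0"
        using that by simp
      ultimately show ?thesis
        by (simp only: mult_divide_mult_cancel_left) (simp add: power2_eq_square mult_ac)
    qed
    from this[of "real n" "2 ^ (4 * n)" "fact n" "fact (2 * n)"] show ?thesis
      unfolding 2 3 by (simp add: power_add add.commute)
  qed
  finally show ?case .
qed simp

text \<open>In \<open>4 * a n - 2 * a (2 * n)\<close> the terms of order n ln n and n cancel except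
  for a multiple of ln 2. Up to explicit logarithms this is the logarithm of Wallis' product, so 2c
  - 2 ln 2 = ln (pi / 2).\<close>

lemma stirling_constant:
  assumes "(\<lambda>n. ln (fact n) - ((real n + 1 / 2) * ln (real n) - real n)) \<longlonglongrightarrow> c"
  shows "c = ln (2 * pi) / 2"
proof -
  define a where "a = (\<lambda>n. ln (fact n) - ((real n + 1 / 2) * ln (real n) - real n))"
  have a: "a \<longlonglongrightarrow> c" using assms by (simp add: a_def)
  have a2: "(\<lambda>n. a (2 * n)) \<longlonglongrightarrow> c"
    using LIMSEQ_subseq_LIMSEQ[OF a, of "\<lambda>n. 2 * n"] by (simp add: strict_mono_def o_def)
  have "(\<lambda>n. ln (1 / (2 + 1 / real n))) \<longlonglongrightarrow> ln (1 / (2 + 0))"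
    by (intro tendsto_intros lim_1_over_n) auto
  hence "(\<lambda>n. 4 * a n - 2 * a (2 * n) + ln (1 / (2 + 1 / real n)) - ln 2)
           \<longlonglongrightarrow> 4 * c - 2 * c + ln (1 / (2 + 0)) - ln 2"
    by (intro tendsto_diff tendsto_add tendsto_mult_left tendsto_const a a2)
  moreover have "\<forall>\<^sub>F n in sequentially. 4 * a n - 2 * a (2 * n) + ln (1 / (2 + 1 / real n)) - ln 2
     = ln (\<Prod>k=1..n. (4*real k^2) / (4*real k^2 - 1))"
  proof (rule eventually_sequentiallyI[of 1])
    fix n :: nat assume n: "n \<ge> 1"
    have "1 / (2 + 1 / real n) = real n / (2 * real n + 1)"
      using n by (simp add: field_simps)
    hence "ln (1 / (2 + 1 / real n)) = ln (real n) - ln (2 * real n + 1)"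
      using n by (simp add: ln_div)
    moreover have "ln (\<Prod>k=1..n. (4*real k^2) / (4*real k^2 - 1)) =
      4 * real n * ln 2 + 4 * ln (fact n) - (2 * ln (fact (2 * n)) + ln (2 * real n + 1))"
      unfolding wallis_product_eq
      by (simp add: ln_div ln_mult ln_realpow)
    moreover have "a (2 * n) = ln (fact (2 * n)) - ((2 * real n + 1 / 2) * (ln 2 + ln (real n)) - 2 * real n)"
      using n by (simp add: a_def ln_mult)
    ultimately show "4 * a n - 2 * a (2 * n) + ln (1 / (2 + 1 / real n)) - ln 2
     = ln (\<Prod>k=1..n. (4*real k^2) / (4*real k^2 - 1))"
      by (simp add: a_def field_simps)
  qed
  ultimately have "(\<lambda>n. ln (\<Prod>k=1..n. (4*real k^2) / (4*real k^2 - 1)))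
       \<longlonglongrightarrow> 4 * c - 2 * c + ln (1 / (2 + 0)) - ln 2"
    by (rule Lim_transform_eventually)
  moreover have "(\<lambda>n. ln (\<Prod>k=1..n. (4*real k^2) / (4*real k^2 - 1))) \<longlonglongrightarrow> ln (pi / 2)"
    by (intro tendsto_ln wallis) auto
  ultimately have "4 * c - 2 * c + ln (1 / (2 + 0)) - ln 2 = ln (pi / 2)"
    using LIMSEQ_unique by blast
  thus ?thesis by (simp add: ln_div ln_mult)
qed

text \<open>The two series are compared through \<open>stirling_log M (real n) 2\<close>: a diagonal
  shift by 1 leads to it from n + 1, the difference equation from n. The mismatch is the Taylor
  remainder of ln (1 + 1/n).\<close>

lemma ln_fact_step:
  "\<exists>D. \<forall>n\<ge>1. \<bar>(ln (fact (Suc n)) - stirling_log M (real (Suc n)) 1)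
               - (ln (fact n) - stirling_log M (real n) 1)\<bar> \<le> D / real n ^ (M + 1)"
proof -
  obtain C where C: "\<And>x t a. 0 < x \<Longrightarrow> x / 2 \<le> x + t \<Longrightarrow> \<bar>t\<bar> \<le> 2 \<Longrightarrow> \<bar>a\<bar> \<le> 2 \<Longrightarrow>
     \<bar>stirling_log M (x + t) (a - t) - stirling_log M x a\<bar> \<le> C / x ^ (M + 1)"
    using stirling_log_shift[of 2 M] by blast
  show ?thesis
  proof (intro exI[of _ "C + 1"] allI impI)
    fix n :: nat assume n: "n \<ge> 1"
    define T where "T = (\<Sum>k = 1..M. (- 1) ^ (k + 1) * (1 / real n) ^ k / real k)"
    have 1: "\<bar>stirling_log M (real (Suc n)) 1 - stirling_log M (real n) 2\<bar> \<le> C / real n ^ (M + 1)"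
      using C[of "real n" 1 2] n by (simp add: add.commute)
    have 2: "stirling_log M (real n) 2 = stirling_log M (real n) 1 + ln (real n) + T"
      using stirling_log_plus_1[of M "real n" 1] by (simp add: T_def power_divide mult.commute)
    have 3: "\<bar>ln (1 + 1 / real n) - T\<bar> \<le> 1 / real n ^ (M + 1)"
      using ln_1_plus_taylor[of "1 / real n" M] by (simp add: T_def power_divide)
    have "1 + 1 / real n = real (Suc n) / real n" using n by (simp add: field_simps)
    hence 4: "ln (1 + 1 / real n) = ln (real (Suc n)) - ln (real n)"
      using n by (simp add: ln_div)
    have "ln (fact (Suc n)) = ln (real (Suc n)) + ln (fact n)"
      by (simp add: ln_mult del: of_nat_Suc)
    with 1 2 3 4 show "\<bar>(ln (fact (Suc n)) - stirling_log M (real (Suc n)) 1)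
               - (ln (fact n) - stirling_log M (real n) 1)\<bar> \<le> (C + 1) / real n ^ (M + 1)"
      unfolding add_divide_distrib by linarith
  qed
qed

text \<open>Summing the increments loses one power of n. The argument therefore runs at order
  \<open>Suc M\<close>, and the extra term of the series is absorbed in the constant.\<close>

lemma ln_fact_expansion:
  "\<exists>C. \<forall>n\<ge>1. \<bar>ln (fact n) - stirling_log M (real n) 1\<bar> \<le> C / real n ^ (M + 1)"
proof -
  define R where "R = (\<lambda>M n. ln (fact n) - stirling_log M (real n) 1)"
  define b where "b = (\<lambda>k. (- 1) ^ (k + 1) * bernpoly (k + 1) 1 / (real k * (real k + 1)))"
  obtain D where "\<And>n. n \<ge> 1 \<Longrightarrow> \<bar>R (Suc M) (Suc n) - R (Suc M) n\<bar> \<le> D / real n ^ (M + 2)"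
    using ln_fact_step[of "Suc M"] by (auto simp: R_def)
  then obtain L where L: "R (Suc M) \<longlonglongrightarrow> L"
    and RL: "\<And>n. n \<ge> 1 \<Longrightarrow> \<bar>R (Suc M) n - L\<bar> \<le> 2 ^ (M + 1) * D / real n ^ (M + 1)"
    using telescoping_limit[of "R (Suc M)" D M] by blast
  \<comment> \<open>Adding back the constant and the correction terms, which tend to 0, produces the
    sequence of \<open>stirling_constant\<close>; hence L + ln (2 pi) / 2 = ln (2 pi) / 2.\<close>
  have "(\<lambda>n. R (Suc M) n + ln (2 * pi) / 2 + (\<Sum>k = 1..Suc M. b k * (1 / real n) ^ k))
          \<longlonglongrightarrow> L + ln (2 * pi) / 2 + (\<Sum>k = 1..Suc M. b k * 0 ^ k)"
    by (intro tendsto_intros L lim_1_over_n)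
  also have "(\<lambda>n. R (Suc M) n + ln (2 * pi) / 2 + (\<Sum>k = 1..Suc M. b k * (1 / real n) ^ k))
              = (\<lambda>n. ln (fact n) - ((real n + 1 / 2) * ln (real n) - real n))"
    by (simp add: fun_eq_iff R_def b_def stirling_log_def power_divide algebra_simps
             del: sum.cl_ivl_Suc)
  also have "(\<Sum>k = 1..Suc M. b k * 0 ^ k) = 0"
    by (intro sum.neutral) auto
  finally have "L = 0"
    using stirling_constant by fastforce
  have "\<bar>R M n\<bar> \<le> (2 ^ (M + 1) * D + \<bar>b (Suc M)\<bar>) / real n ^ (M + 1)" if n: "n \<ge> 1" for n
  proof -
    have "R M n = R (Suc M) n + b (Suc M) / real n ^ (M + 1)"
      unfolding R_def stirling_log_Suc b_def by (simp add: add_ac)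
    moreover have "\<bar>b (Suc M) / real n ^ (M + 1)\<bar> = \<bar>b (Suc M)\<bar> / real n ^ (M + 1)"
      by simp
    ultimately show ?thesis
      using RL[OF n] unfolding \<open>L = 0\<close> add_divide_distrib by linarith
  qed
  thus ?thesis unfolding R_def by blast
qed

subsection \<open>The expansion of the binomial probabilities\<close>

text \<open>The point \<open>(j, 1)\<close> equals \<open>(x + h, (h + 1) - h)\<close>, so it is the
  diagonal shift of \<open>(x, h + 1)\<close> by \<open>h\<close>. The bound
  \<open>2 * B < x\<close> keeps \<open>j\<close> at least \<open>x / 2\<close>.\<close>

lemma ln_fact_shifted_expansion:
  assumes "B \<ge> 0"
  shows "\<exists>C\<ge>0. \<forall>x h j. \<bar>h\<bar> \<le> B \<and> 2 * B < x \<and> real j = x + h \<longrightarrow>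
           \<bar>ln (fact j) - stirling_log M x (h + 1)\<bar> \<le> C / x ^ (M + 1)"
proof -
  obtain C1 where C1: "\<And>x t a. 0 < x \<Longrightarrow> x / 2 \<le> x + t \<Longrightarrow> \<bar>t\<bar> \<le> B + 1 \<Longrightarrow> \<bar>a\<bar> \<le> B + 1 \<Longrightarrow>
     \<bar>stirling_log M (x + t) (a - t) - stirling_log M x a\<bar> \<le> C1 / x ^ (M + 1)"
    using stirling_log_shift[of "B + 1" M] by blast
  obtain C2 where C2: "\<And>n. n \<ge> 1 \<Longrightarrow>
      \<bar>ln (fact n) - stirling_log M (real n) 1\<bar> \<le> C2 / real n ^ (M + 1)"
    using ln_fact_expansion[of M] by blast
  have C1_0: "C1 \<ge> 0"
    using C1[of 1 0 0] assms by simp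
  have C2_0: "C2 \<ge> 0"
    using C2[of 1] by (simp add: order.trans[OF abs_ge_zero])
  show ?thesis
  proof (intro exI[of _ "C1 + C2 * 2 ^ (M + 1)"] conjI allI impI; (elim conjE)?)
    fix x h :: real and j :: nat
    assume h: "\<bar>h\<bar> \<le> B" and x: "2 * B < x" and j: "real j = x + h"
    have x0: "x > 0" and half: "x / 2 \<le> x + h"
      using h x assms by (auto simp: abs_if split: if_splits)
    hence "real j > 0" using j by linarith
    hence j1: "j \<ge> 1" by simp
    have "\<bar>stirling_log M (x + h) (h + 1 - h) - stirling_log M x (h + 1)\<bar> \<le> C1 / x ^ (M + 1)"
      using h assms by (intro C1 x0 half) auto
    hence 1: "\<bar>stirling_log M (real j) 1 - stirling_log M x (h + 1)\<bar> \<le> C1 / x ^ (M + 1)"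
      by (simp add: j)
    have "C2 / real j ^ (M + 1) \<le> C2 / (x / 2) ^ (M + 1)"
      using C2_0 x0 half j by (intro divide_left_mono power_mono mult_pos_pos zero_less_power) auto
    hence 2: "\<bar>ln (fact j) - stirling_log M (real j) 1\<bar> \<le> C2 * 2 ^ (M + 1) / x ^ (M + 1)"
      using C2[OF j1] by (simp add: power_divide)
    show "\<bar>ln (fact j) - stirling_log M x (h + 1)\<bar> \<le> (C1 + C2 * 2 ^ (M + 1)) / x ^ (M + 1)"
      using 1 2 unfolding add_divide_distrib by linarith
  qed (use C1_0 C2_0 in auto)
qed

text \<open>The terms come from N!, (Np + h)! and (N(1 - p) - h)!. The second is split by the
  difference equation, which yields the separate power of \<open>h\<close>; the third is reflected,
  which yields the sign at the power of \<open>1 - p\<close>.\<close>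

lemma A_coeff_eq_stirling_terms:
  assumes "k \<ge> 1" "N > 0" "0 < p" "p < 1"
  shows "(- 1) ^ (k + 1) * bernpoly (k + 1) 1 / (real k * (real k + 1) * N ^ k)
         - (- 1) ^ (k + 1) * bernpoly (k + 1) h / (real k * (real k + 1) * (N * p) ^ k)
         - (- 1) ^ (k + 1) * h ^ k / (real k * (N * p) ^ k)
         - (- 1) ^ (k + 1) * bernpoly (k + 1) (1 - h) / (real k * (real k + 1) * (N * (1 - p)) ^ k)
       = A_coeff k h p / N ^ k"
proof -
  \<comment> \<open>Here \<open>k \<ge> 1\<close> matters, because the difference equation adds a
    multiple of \<open>0 ^ k\<close>.\<close>
  have b: "bernpoly (k + 1) 1 = bernoulli (k + 1)"
    using bernpoly_plus_1[of k 0] assms by (simp add: bernoulli_def)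
  \<comment> \<open>With \<open>s\<close> for the sign, the identity is purely rational and does not
    need \<open>s * s = 1\<close>.\<close>
  have "s * b / (k1 * k2 * n) - s * bh / (k1 * k2 * (n * pk)) - s * hk / (k1 * (n * pk))
          - s * (s * bh) / (k1 * k2 * (n * qk))
        = (s / (k1 * k2) * (b - (1 / pk + s * (1 / qk)) * bh) - s * hk / (k1 * pk)) / n"
    if "k1 \<noteq> 0" "k2 \<noteq> 0" "n \<noteq> 0" "pk \<noteq> 0" "qk \<noteq> 0" for s b k1 k2 n bh pk hk qk :: real
    using that by (simp add: field_simps)
  from this[of "real k" "real k + 1" "N ^ k" "p ^ k" "(1 - p) ^ k" "(- 1) ^ (k + 1)"
              "bernoulli (k + 1)" "bernpoly (k + 1) h" "h ^ k"]
  show ?thesis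
    using assms unfolding b bernpoly_reflect A_coeff_def power_mult_distrib by simp
qed

text \<open>The logarithms of \<open>p\<close> and \<open>1 - p\<close> coming from the scaled
  arguments cancel the powers in the binomial weight, except for the halves that form the leading
  factor.\<close>

lemma stirling_log_combination:
  assumes "N > 0" "0 < p" "p < 1"
  shows "stirling_log M N 1 - stirling_log M (N * p) (h + 1) - stirling_log M (N * (1 - p)) (1 - h)
           + (N * p + h) * ln p + (N * (1 - p) - h) * ln (1 - p)
         = - ln (2 * pi * N * p * (1 - p)) / 2 + (\<Sum>k = 1..M. A_coeff k h p / N ^ k)"
proof -
  have lns: "ln (N * p) = ln N + ln p" "ln (N * (1 - p)) = ln N + ln (1 - p)"
    "ln (2 * pi * N * p * (1 - p)) = ln (2 * pi) + ln N + ln p + ln (1 - p)"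
    using assms by (simp_all add: ln_mult)
  have "(\<Sum>k = 1..M. A_coeff k h p / N ^ k) =
     (\<Sum>k = 1..M. (- 1) ^ (k + 1) * bernpoly (k + 1) 1 / (real k * (real k + 1) * N ^ k))
     - (\<Sum>k = 1..M. (- 1) ^ (k + 1) * bernpoly (k + 1) h / (real k * (real k + 1) * (N * p) ^ k))
     - (\<Sum>k = 1..M. (- 1) ^ (k + 1) * h ^ k / (real k * (N * p) ^ k))
     - (\<Sum>k = 1..M. (- 1) ^ (k + 1) * bernpoly (k + 1) (1 - h) / (real k * (real k + 1) * (N * (1 - p)) ^ k))"
    unfolding sum_subtractf[symmetric] using assms
    by (intro sum.cong refl A_coeff_eq_stirling_terms[symmetric]) auto
  thus ?thesis
    unfolding stirling_log_plus_1 by (simp only: stirling_log_def lns) (simp add: field_simps)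
qed

lemma ln_binom_prob:
  assumes "0 < p" "p < 1" "j \<le> N" "real N * p + h = real j"
  shows "binom_prob N h p > 0"
    and "ln (binom_prob N h p) = ln (fact N) - ln (fact j) - ln (fact (N - j))
           + (real N * p + h) * ln p + (real N * (1 - p) - h) * ln (1 - p)"
proof -
  have floor: "nat \<lfloor>real N * p + h\<rfloor> = j"
    unfolding assms(4) by simp
  have b: "real (N choose j) > 0"
    using assms(3) by simp
  have eq: "binom_prob N h p = real (N choose j) *
      (p powr (real N * p + h) * (1 - p) powr (real N * (1 - p) - h))"
    by (simp add: binom_prob_def floor)
  show "binom_prob N h p > 0"
    unfolding eq using b assms by simp
  have "ln (real (N choose j)) = ln (fact N) - ln (fact j) - ln (fact (N - j))"
    using assms(3) by (simp add: binomial_fact ln_div ln_mult)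
  thus "ln (binom_prob N h p) = ln (fact N) - ln (fact j) - ln (fact (N - j))
           + (real N * p + h) * ln p + (real N * (1 - p) - h) * ln (1 - p)"
    unfolding eq using b assms by (simp add: ln_mult ln_powr)
qed

lemma leading_factor_pos:
  assumes "N \<ge> 1" "0 < p" "p < 1"
  shows "leading_factor N p > 0"
  using assms by (simp add: leading_factor_def)

lemma ln_leading_factor:
  assumes "N \<ge> 1" "0 < p" "p < 1"
  shows "ln (leading_factor N p) = - ln (2 * pi * real N * p * (1 - p)) / 2"
  using assms by (simp add: leading_factor_def ln_div ln_sqrt)

text \<open>The shifted expansion is applied to the three factorials at \<open>N\<close>,
  \<open>N * p\<close> and \<open>N * (1 - p)\<close> with shifts 0, \<open>h\<close> and
  \<open>- h\<close>.\<close>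

lemma ln_binom_prob_expansion:
  assumes "bounded H" "0 < a" "b < 1"
  shows "\<exists>C\<ge>0. \<forall>\<^sub>F N in sequentially. \<forall>(h, p) \<in> admissible H {a..b} N.
           \<bar>ln (binom_prob N h p) - ln (leading_factor N p) - (\<Sum>k = 1..M. A_coeff k h p / real N ^ k)\<bar>
             \<le> C / real N ^ (M + 1)"
proof -
  obtain B where B: "B \<ge> 0" "\<And>h. h \<in> H \<Longrightarrow> \<bar>h\<bar> \<le> B"
    using assms(1) unfolding bounded_iff by (metis abs_ge_zero order.trans real_norm_def linorder_le_cases)
  obtain C where C: "C \<ge> 0" "\<And>x h j. \<bar>h\<bar> \<le> B \<Longrightarrow> 2 * B < x \<Longrightarrow> real j = x + h \<Longrightarrow>
      \<bar>ln (fact j) - stirling_log M x (h + 1)\<bar> \<le> C / x ^ (M + 1)"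
    using ln_fact_shifted_expansion[OF B(1), of M] by blast
  \<comment> \<open>A common lower bound for \<open>p\<close> and \<open>1 - p\<close>; it makes
    threshold and constant uniform in \<open>p\<close>.\<close>
  define \<alpha> where "\<alpha> = min a (1 - b)"
  have \<alpha>: "\<alpha> > 0" using assms by (simp add: \<alpha>_def)
  \<comment> \<open>One \<open>C\<close> for N!, and one rescaled constant for each factorial in the
    denominator.\<close>
  define C' where "C' = C + 2 * (C / \<alpha> ^ (M + 1))"
  have scaled: "2 * B < real N * r \<and> C / (real N * r) ^ (M + 1) \<le> C / \<alpha> ^ (M + 1) / real N ^ (M + 1)"
    if "real N > 2 * B / \<alpha>" "r \<ge> \<alpha>" for N r
  proof -
    have "0 \<le> 2 * B / \<alpha>" using B \<alpha> by simp
    hence N: "real N > 0" using that by linarith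
    have "2 * B < real N * \<alpha>" using that \<alpha> by (simp add: field_simps)
    also have le: "\<dots> \<le> real N * r" using that N by (intro mult_left_mono) auto
    finally have "2 * B < real N * r" .
    moreover have "C / (real N * r) ^ (M + 1) \<le> C / (real N * \<alpha>) ^ (M + 1)"
      using C(1) \<alpha> N le that
      by (intro divide_left_mono power_mono mult_pos_pos zero_less_power) auto
    ultimately show ?thesis by (simp add: power_mult_distrib mult_ac)
  qed
  have bound: "\<bar>ln (binom_prob N h p) - ln (leading_factor N p) - (\<Sum>k = 1..M. A_coeff k h p / real N ^ k)\<bar>
             \<le> C' / real N ^ (M + 1)"
    if N: "real N > 2 * B" "real N > 2 * B / \<alpha>" and y: "(h, p) \<in> admissible H {a..b} N" for N h p
  proof -
    from y obtain j where j: "j \<le> N" "real N * p + h = real j" and h: "\<bar>h\<bar> \<le> B" and p: "a \<le> p" "p \<le> b"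
      using B by (auto simp: admissible_def)
    have p01: "0 < p" "p < 1" and p\<alpha>: "p \<ge> \<alpha>" "1 - p \<ge> \<alpha>"
      using p assms by (auto simp: \<alpha>_def)
    have N1: "N \<ge> 1" using N B by (cases N) auto
    have 1: "\<bar>ln (fact N) - stirling_log M (real N) 1\<bar> \<le> C / real N ^ (M + 1)"
      using C(2)[of 0 "real N" N] B(1) N by simp
    have 2: "\<bar>ln (fact j) - stirling_log M (real N * p) (h + 1)\<bar> \<le> C / \<alpha> ^ (M + 1) / real N ^ (M + 1)"
      using C(2)[OF h, of "real N * p" j] scaled[OF N(2) p\<alpha>(1)] j by linarith
    have "real (N - j) = real N * (1 - p) + (- h)"
      using j by (simp add: of_nat_diff algebra_simps)
    hence 3: "\<bar>ln (fact (N - j)) - stirling_log M (real N * (1 - p)) (1 - h)\<bar> \<le> C / \<alpha> ^ (M + 1) / real N ^ (M + 1)"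
      using C(2)[of "- h" "real N * (1 - p)" "N - j"] h scaled[OF N(2) p\<alpha>(2)] by simp
    show ?thesis
      using 1 2 3 stirling_log_combination[of "real N" p M h] N1 p01
        ln_binom_prob(2)[OF p01 j] ln_leading_factor[OF N1 p01]
      unfolding C'_def add_divide_distrib by linarith
  qed
  obtain N0 :: nat where "real N0 > max (2 * B) (2 * B / \<alpha>)"
    using reals_Archimedean2 by blast
  hence "\<forall>N\<ge>N0. \<forall>(h, p) \<in> admissible H {a..b} N.
       \<bar>ln (binom_prob N h p) - ln (leading_factor N p) - (\<Sum>k = 1..M. A_coeff k h p / real N ^ k)\<bar>
             \<le> C' / real N ^ (M + 1)"
    using bound by fastforce
  moreover have "C' \<ge> 0" using C \<alpha> by (simp add: C'_def)
  ultimately show ?thesis unfolding eventually_sequentially by blast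
qed

section \<open>Exponentiating a truncated series\<close>

lemma sum_triangle_reindex:
  fixes g :: "nat \<Rightarrow> nat \<Rightarrow> 'a :: comm_monoid_add"
  shows "(\<Sum>m = 1..M. \<Sum>k = 1..m. g k (m - k)) = (\<Sum>k = 1..M. \<Sum>n \<le> M - k. g k n)"
  unfolding sum.Sigma[OF finite_atLeastAtMost ballI[OF finite_atLeastAtMost]]
    sum.Sigma[OF finite_atLeastAtMost ballI[OF finite_atMost]]
  by (rule sum.reindex_bij_witness[of _ "\<lambda>(k, n). (k + n, k)" "\<lambda>(m, k). (k, m - k)"]) auto

text \<open>The bound depends only on \<open>M\<close>, \<open>K\<close> and \<open>u\<close>, so it
  is uniform in any parameters behind \<open>A\<close> and \<open>c\<close>.\<close>

lemma exp_series_truncation: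
  fixes A c :: "nat \<Rightarrow> real"
  assumes c0: "c 0 = 1"
    and rec: "\<And>m. real (Suc m) * c (Suc m) = (\<Sum>k = 1..Suc m. real k * A k * c (Suc m - k))"
    and A: "\<And>k. 1 \<le> k \<Longrightarrow> k \<le> M \<Longrightarrow> \<bar>A k\<bar> \<le> K" and c: "\<And>n. n \<le> M \<Longrightarrow> \<bar>c n\<bar> \<le> K"
    and u: "0 \<le> u" "u \<le> 1"
  shows "\<bar>(\<Sum>n\<le>M. c n * u ^ n) * exp (- (\<Sum>k = 1..M. A k * u ^ k)) - 1\<bar>
           \<le> (\<Sum>k = 1..M. \<Sum>n\<le>M. real M * (K * K)) * exp (real M * K) * u ^ (M + 1)"
proof -
  define P where "P = (\<lambda>v. \<Sum>n\<le>M. c n * v ^ n)"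
  define L where "L = (\<lambda>v. \<Sum>k = 1..M. A k * v ^ k)"
  define P' where "P' = (\<lambda>v. \<Sum>n\<le>M. c n * (real n * v ^ (n - 1)))"
  define L' where "L' = (\<lambda>v. \<Sum>k = 1..M. A k * (real k * v ^ (k - 1)))"
  define Q where "Q = (\<Sum>k = 1..M. \<Sum>n\<le>M. real M * (K * K))"
  have K: "K \<ge> 0" using c[of 0] c0 by simp
  have DP: "(P has_real_derivative P' v) (at v)" for v
    unfolding P_def P'_def by (auto intro!: DERIV_sum derivative_eq_intros)
  have DL: "(L has_real_derivative L' v) (at v)" for v
    unfolding L_def L'_def by (auto intro!: DERIV_sum derivative_eq_intros)
  have D: "((\<lambda>v. P v * exp (- L v)) has_real_derivative ((P' v - L' v * P v) * exp (- L v))) (at v)" for v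
    by (rule derivative_eq_intros DP DL refl)+ (simp add: algebra_simps)
  have bound_L: "- L v \<le> real M * K" if "0 \<le> v" "v \<le> 1" for v
  proof -
    have "- L v \<le> \<bar>L v\<bar>" by simp
    also have "\<bar>L v\<bar> \<le> (\<Sum>k = 1..M. K * 1)"
      unfolding L_def
    proof (intro order.trans[OF sum_abs] sum_mono)
      fix k assume "k \<in> {1..M}"
      hence "\<bar>A k\<bar> * v ^ k \<le> K * 1"
        using A that K by (intro mult_mono power_le_one) auto
      thus "\<bar>A k * v ^ k\<bar> \<le> K * 1"
        using that by (simp add: abs_mult power_abs)
    qed
    finally show ?thesis by simp
  qed
  have bound_D: "\<bar>P' v - L' v * P v\<bar> \<le> Q * u ^ M" if v: "0 \<le> v" "v \<le> u" for v
  proof -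
    define F where "F = (\<lambda>k n. real k * A k * c n * v ^ (k + n - 1))"
    have "L' v * P v = (\<Sum>k = 1..M. \<Sum>n\<le>M. F k n)"
      unfolding L'_def P_def sum_product
    proof (intro sum.cong refl)
      fix k n assume "k \<in> {1..M}"
      hence "v ^ (k - 1) * v ^ n = v ^ (k + n - 1)"
        by (simp flip: power_add)
      thus "A k * (real k * v ^ (k - 1)) * (c n * v ^ n) = F k n"
        by (simp add: F_def mult_ac)
    qed
    \<comment> \<open>By the recurrence, \<open>P'\<close> is exactly the part of the product
      \<open>L' * P\<close> with k + n at most \<open>M\<close>.\<close>
    moreover have "P' v = (\<Sum>k = 1..M. \<Sum>n\<le>M - k. F k n)"
    proof -
      have "P' v = (\<Sum>m = 1..M. real m * c m * v ^ (m - 1))"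
        unfolding P'_def by (intro sum.mono_neutral_cong_right) (auto simp: not_le)
      also have "\<dots> = (\<Sum>m = 1..M. \<Sum>k = 1..m. F k (m - k))"
      proof (intro sum.cong refl)
        fix m assume m: "m \<in> {1..M}"
        then obtain i where i: "m = Suc i" by (cases m) auto
        have "real m * c m * v ^ (m - 1) = (\<Sum>k = 1..m. real k * A k * c (m - k)) * v ^ (m - 1)"
          unfolding i rec ..
        also have "\<dots> = (\<Sum>k = 1..m. F k (m - k))"
          unfolding sum_distrib_right F_def by (intro sum.cong) auto
        finally show "real m * c m * v ^ (m - 1) = (\<Sum>k = 1..m. F k (m - k))" .
      qed
      also have "\<dots> = (\<Sum>k = 1..M. \<Sum>n\<le>M - k. F k n)"
        by (rule sum_triangle_reindex)
      finally show ?thesis .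
    qed
    \<comment> \<open>Only pairs with k + n > \<open>M\<close> survive; their degree k + n - 1 is at
      least \<open>M\<close>, and \<open>u \<le> 1\<close> bounds them by
      \<open>u ^ M\<close>.\<close>
    ultimately have "L' v * P v - P' v = (\<Sum>k = 1..M. (\<Sum>n\<le>M. F k n) - (\<Sum>n\<le>M - k. F k n))"
      by (simp add: sum_subtractf)
    also have "\<dots> = (\<Sum>k = 1..M. \<Sum>n \<in> {..M} - {..M - k}. F k n)"
      by (intro sum.cong refl sum_diff[symmetric]) auto
    finally have "\<bar>P' v - L' v * P v\<bar> = \<bar>\<Sum>k = 1..M. \<Sum>n \<in> {..M} - {..M - k}. F k n\<bar>"
      by (simp add: abs_minus_commute)
    also have "\<dots> \<le> (\<Sum>k = 1..M. \<Sum>n \<in> {..M} - {..M - k}. \<bar>F k n\<bar>)"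
      by (intro order.trans[OF sum_abs] sum_mono sum_abs)
    also have "\<dots> \<le> (\<Sum>k = 1..M. \<Sum>n \<in> {..M} - {..M - k}. real M * (K * K) * u ^ M)"
    proof (intro sum_mono)
      fix k n assume k: "k \<in> {1..M}" and n: "n \<in> {..M} - {..M - k}"
      have "v ^ (k + n - 1) \<le> u ^ (k + n - 1)"
        using v by (intro power_mono) auto
      also have "\<dots> \<le> u ^ M"
        using k n u by (intro power_decreasing) auto
      finally have "v ^ (k + n - 1) \<le> u ^ M" .
      hence "(real k * (\<bar>A k\<bar> * \<bar>c n\<bar>)) * v ^ (k + n - 1) \<le> (real M * (K * K)) * u ^ M"
        using A[of k] c[of n] k n v K by (intro mult_mono) auto
      thus "\<bar>F k n\<bar> \<le> real M * (K * K) * u ^ M"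
        using v by (simp add: F_def abs_mult power_abs mult_ac)
    qed
    also have "\<dots> \<le> (\<Sum>k = 1..M. \<Sum>n\<le>M. real M * (K * K) * u ^ M)"
      using K u by (intro sum_mono sum_mono2) auto
    also have "\<dots> = Q * u ^ M"
      unfolding Q_def by simp
    finally show ?thesis .
  qed
  have "norm (P u * exp (- L u) - P 0 * exp (- L 0)) \<le> Q * u ^ M * exp (real M * K) * norm (u - 0)"
  proof (rule field_differentiable_bound[where S = "{0..u}" and f' = "\<lambda>v. (P' v - L' v * P v) * exp (- L v)"])
    fix v assume v: "v \<in> {0..u}"
    show "((\<lambda>v. P v * exp (- L v)) has_field_derivative (P' v - L' v * P v) * exp (- L v)) (at v within {0..u})"
      by (rule has_field_derivative_at_within[OF D])
    have "\<bar>P' v - L' v * P v\<bar> * exp (- L v) \<le> (Q * u ^ M) * exp (real M * K)"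
      using v bound_D[of v] bound_L[of v] u by (intro mult_mono) (auto intro: order.trans[OF abs_ge_zero])
    thus "norm ((P' v - L' v * P v) * exp (- L v)) \<le> Q * u ^ M * exp (real M * K)"
      by (simp add: abs_mult)
  qed (use u in auto)
  moreover have "P 0 = 1"
  proof -
    have "P 0 = (\<Sum>n\<in>{0}. c n * 0 ^ n)"
      unfolding P_def by (intro sum.mono_neutral_right) auto
    thus ?thesis by (simp add: c0)
  qed
  moreover have "L 0 = 0"
    unfolding L_def by (intro sum.neutral) auto
  ultimately show ?thesis
    using u by (simp add: P_def L_def Q_def mult_ac)
qed

text \<open>The composite solves E' = L' E with E(0) = 1, and comparing coefficients gives the
  recurrence of \<open>c\<close>. Truncating L at \<open>M\<close> leaves the coefficients up to
  \<open>M\<close> unchanged.\<close>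

lemma fps_exp_compose_nth:
  fixes A c :: "nat \<Rightarrow> real"
  assumes c0: "c 0 = 1"
    and rec: "\<And>m. real (Suc m) * c (Suc m) = (\<Sum>k = 1..Suc m. real k * A k * c (Suc m - k))"
    and "n \<le> M"
  shows "fps_nth (fps_exp 1 oo (\<Sum>k = 1..M. fps_const (A k) * fps_X ^ k)) n = c n"
proof -
  define L where "L = (\<Sum>k = 1..M. fps_const (A k) * fps_X ^ k)"
  define E where "E = fps_exp 1 oo L"
  have L_nth: "fps_nth L i = (if 1 \<le> i \<and> i \<le> M then A i else 0)" for i
  proof -
    have "fps_nth L i = (\<Sum>k = 1..M. if i = k then A k else 0)"
      unfolding L_def fps_sum_nth by (intro sum.cong) (auto simp: fps_X_power_nth)
    thus ?thesis by (simp add: sum.delta')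
  qed
  have "fps_deriv E = fps_deriv L * E"
    unfolding E_def by (subst fps_compose_deriv) (auto simp: L_nth mult.commute)
  hence deriv: "real (Suc m) * fps_nth E (Suc m) = (\<Sum>i = 0..m. real (Suc i) * fps_nth L (Suc i) * fps_nth E (m - i))" for m
    by (metis (no_types, lifting) Suc_eq_plus1 fps_deriv_nth fps_mult_nth sum.cong)
  have "fps_nth E n = c n" using \<open>n \<le> M\<close>
  proof (induction n rule: less_induct)
    case (less n)
    show ?case
    proof (cases n)
      case 0
      thus ?thesis by (simp add: E_def c0)
    next
      case (Suc m)
      have "real (Suc m) * fps_nth E (Suc m) = (\<Sum>i = 0..m. real (Suc i) * A (Suc i) * c (m - i))"
        unfolding deriv using less Suc by (intro sum.cong) (auto simp: L_nth)
      also have "\<dots> = real (Suc m) * c (Suc m)"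
        unfolding rec using sum.shift_bounds_cl_Suc_ivl[of "\<lambda>k. real k * A k * c (Suc m - k)" 0 m]
        by simp
      finally show ?thesis by (simp add: Suc)
    qed
  qed
  thus ?thesis by (simp add: E_def L_def)
qed

lemma c_coeff_rec:
  "real (Suc m) * c_coeff (Suc m) h p = (\<Sum>k = 1..Suc m. real k * A_coeff k h p * c_coeff (Suc m - k) h p)"
  by (simp del: of_nat_Suc sum.cl_ivl_Suc)

section \<open>Uniform bounds for the coefficients on compact parameter sets\<close>

lemma continuous_on_A_coeff:
  assumes "k \<ge> 1" "\<And>y. y \<in> S \<Longrightarrow> 0 < snd y \<and> snd y < 1"
  shows "continuous_on S (\<lambda>y. A_coeff k (fst y) (snd y))"
proof -
  have "snd y \<noteq> 0" "1 - snd y \<noteq> 0" if "y \<in> S" for y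
    using assms(2)[OF that] by auto
  thus ?thesis
    using assms(1) unfolding A_coeff_def by (intro continuous_intros) auto
qed

lemma continuous_on_c_coeff:
  assumes "\<And>y. y \<in> S \<Longrightarrow> 0 < snd y \<and> snd y < 1"
  shows "continuous_on S (\<lambda>y. c_coeff n (fst y) (snd y))"
proof (induction n rule: less_induct)
  case (less n)
  show ?case
  proof (cases n)
    case (Suc m)
    show ?thesis
      unfolding Suc c_coeff.simps
      by (intro continuous_intros continuous_on_A_coeff assms less) (auto simp: Suc)
  qed simp
qed

lemma coeffs_uniformly_bounded:
  assumes "compact H" "0 < a" "b < 1"
  shows "\<exists>K. \<forall>h\<in>H. \<forall>p\<in>{a..b}. (\<forall>k. 1 \<le> k \<and> k \<le> M \<longrightarrow> \<bar>A_coeff k h p\<bar> \<le> K)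
                                \<and> (\<forall>n\<le>M. \<bar>c_coeff n h p\<bar> \<le> K)"
proof -
  \<comment> \<open>Adding all absolute values gives a single continuous function, whose bound on
    the compact product serves every coefficient at once.\<close>
  define f where "f = (\<lambda>y. (\<Sum>k = 1..M. \<bar>A_coeff k (fst y) (snd y)\<bar>) + (\<Sum>n\<le>M. \<bar>c_coeff n (fst y) (snd y)\<bar>))"
  have "continuous_on (H \<times> {a..b}) f"
    unfolding f_def
    by (intro continuous_intros continuous_on_A_coeff continuous_on_c_coeff) (use assms in auto)
  hence "compact (f ` (H \<times> {a..b}))"
    by (intro compact_continuous_image compact_Times assms compact_Icc)
  then obtain K where K: "\<forall>z \<in> f ` (H \<times> {a..b}). norm z \<le> K"
    using compact_imp_bounded bounded_iff by metis
  have fK: "f (h, p) \<le> K" if "h \<in> H" "p \<in> {a..b}" for h p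
    using K that by (auto simp: abs_le_iff)
  have "\<bar>A_coeff k h p\<bar> \<le> f (h, p)" if "1 \<le> k" "k \<le> M" for k h p
    unfolding f_def using that
    by (intro add_increasing2 sum_nonneg order.trans[OF _ member_le_sum[of k]]) auto
  moreover have "\<bar>c_coeff n h p\<bar> \<le> f (h, p)" if "n \<le> M" for n h p
    unfolding f_def using that
    by (intro add_increasing sum_nonneg order.trans[OF _ member_le_sum[of n]]) auto
  ultimately show ?thesis
    using fK by (intro exI[of _ K]) (meson order.trans)
qed

section \<open>From logarithms back to probabilities\<close>

lemma abs_exp_minus_1_le:
  fixes x :: real
  assumes "\<bar>x\<bar> \<le> d"
  shows "\<bar>exp x - 1\<bar> \<le> \<bar>x\<bar> * exp d"
proof -
  have d: "1 \<le> exp d" using assms by simp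
  \<comment> \<open>The tangent inequality at \<open>- x\<close>, multiplied by
    \<open>exp x\<close>, yields the upper bound; the one at \<open>x\<close> yields the lower
    bound.\<close>
  have "(1 - x) * exp x \<le> exp (- x) * exp x"
    using exp_ge_add_one_self[of "- x"] by (intro mult_right_mono) auto
  hence "exp x - 1 \<le> x * exp x"
    by (simp add: algebra_simps flip: exp_add)
  also have "\<dots> \<le> \<bar>x\<bar> * exp d"
    using assms by (intro mult_mono) auto
  finally have "exp x - 1 \<le> \<bar>x\<bar> * exp d" .
  moreover have "\<bar>x\<bar> * 1 \<le> \<bar>x\<bar> * exp d"
    using d by (intro mult_left_mono) auto
  moreover have "1 + x \<le> exp x" by (rule exp_ge_add_one_self)
  ultimately show ?thesis by linarith
qed

text \<open>The ratio to the leading factor is exp (L + \<rho>), with \<rho> the logarithmic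
  remainder. Replacing exp \<rho> by 1 and exp L by its re-expansion P each costs O(N^-(M +
  1)).\<close>

lemma binom_prob_expansion:
  assumes "compact H" "0 < a" "b < 1"
  shows "uniform_expansion (\<lambda>N (h, p). binom_prob N h p) (\<lambda>N (h, p). leading_factor N p)
           (\<lambda>_ m (h, p). c_coeff m h p) (admissible H {a..b})"
  unfolding uniform_expansion_def
proof
  fix M
  obtain C where C: "C \<ge> 0" and ev: "\<forall>\<^sub>F N in sequentially. \<forall>(h, p) \<in> admissible H {a..b} N.
           \<bar>ln (binom_prob N h p) - ln (leading_factor N p) - (\<Sum>k = 1..M. A_coeff k h p / real N ^ k)\<bar>
             \<le> C / real N ^ (M + 1)"
    using ln_binom_prob_expansion[OF compact_imp_bounded[OF assms(1)] assms(2,3), of M] by blast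
  obtain K where K: "\<And>h p k. h \<in> H \<Longrightarrow> p \<in> {a..b} \<Longrightarrow> 1 \<le> k \<Longrightarrow> k \<le> M \<Longrightarrow> \<bar>A_coeff k h p\<bar> \<le> K"
     "\<And>h p n. h \<in> H \<Longrightarrow> p \<in> {a..b} \<Longrightarrow> n \<le> M \<Longrightarrow> \<bar>c_coeff n h p\<bar> \<le> K"
    using coeffs_uniformly_bounded[OF assms, of M] by blast
  define Q where "Q = (\<Sum>k = 1..M. \<Sum>n\<le>M. real M * (K * K)) * exp (real M * K)"
  define D where "D = exp (real M * K) * (C * exp C + Q)"
  have main: "\<exists>r. binom_prob N h p = leading_factor N p * ((\<Sum>n\<le>M. c_coeff n h p / real N ^ n) + r)
                 \<and> \<bar>r\<bar> \<le> D / real N ^ (M + 1)"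
    if N: "N \<ge> 1" and y: "(h, p) \<in> admissible H {a..b} N"
      and le: "\<bar>ln (binom_prob N h p) - ln (leading_factor N p) - (\<Sum>k = 1..M. A_coeff k h p / real N ^ k)\<bar>
             \<le> C / real N ^ (M + 1)" for N h p
  proof -
    from y obtain j where j: "j \<le> N" "real N * p + h = real j" and hp: "h \<in> H" "p \<in> {a..b}"
      by (auto simp: admissible_def)
    have p01: "0 < p" "p < 1" using hp assms by auto
    define u where "u = 1 / real N"
    have u: "0 \<le> u" "u \<le> 1" using N by (auto simp: u_def)
    have pow_u: "x / real N ^ i = x * u ^ i" for x i
      by (simp add: u_def power_divide)
    define L where "L = (\<Sum>k = 1..M. A_coeff k h p * u ^ k)"
    define P where "P = (\<Sum>n\<le>M. c_coeff n h p * u ^ n)"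
    define \<rho> where "\<rho> = ln (binom_prob N h p) - ln (leading_factor N p) - L"
    have \<rho>: "\<bar>\<rho>\<bar> \<le> C * u ^ (M + 1)"
      using le unfolding pow_u \<rho>_def L_def by simp
    also have "\<dots> \<le> C"
      using C u by (intro mult_left_le power_le_one) auto
    finally have "\<bar>exp \<rho> - 1\<bar> \<le> \<bar>\<rho>\<bar> * exp C"
      by (rule abs_exp_minus_1_le)
    also have "\<dots> \<le> C * u ^ (M + 1) * exp C"
      using \<rho> by (intro mult_right_mono) auto
    finally have 1: "\<bar>exp \<rho> - 1\<bar> \<le> C * exp C * u ^ (M + 1)"
      by (simp add: mult_ac)
    have 2: "\<bar>P * exp (- L) - 1\<bar> \<le> Q * u ^ (M + 1)"
      unfolding P_def L_def Q_def
      by (rule exp_series_truncation[OF _ c_coeff_rec]) (use K hp u in auto)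
    have "L \<le> (\<Sum>k = 1..M. K * 1)"
      unfolding L_def
    proof (rule sum_mono)
      fix k assume k: "k \<in> {1..M}"
      have "A_coeff k h p * u ^ k \<le> \<bar>A_coeff k h p\<bar> * u ^ k"
        using u by (intro mult_right_mono) auto
      also have "\<dots> \<le> K * 1"
        using K(1)[OF hp, of k] k u by (intro mult_mono power_le_one) auto
      finally show "A_coeff k h p * u ^ k \<le> K * 1" .
    qed
    hence L: "exp L \<le> exp (real M * K)" by simp
    define r where "r = exp (L + \<rho>) - P"
    have "binom_prob N h p = exp (ln (leading_factor N p) + (L + \<rho>))"
      using ln_binom_prob(1)[OF p01 j] by (simp add: \<rho>_def)
    also have "\<dots> = leading_factor N p * (P + r)"
      using leading_factor_pos[OF N p01] by (simp add: exp_add r_def)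
    finally have eq: "binom_prob N h p = leading_factor N p * (P + r)" .
    \<comment> \<open>This separates the two errors, each already bounded, behind the bounded factor
      \<open>exp L\<close>.\<close>
    have "r = exp L * ((exp \<rho> - 1) - (P * exp (- L) - 1))"
      by (simp add: r_def exp_add exp_minus field_simps)
    hence "\<bar>r\<bar> = exp L * \<bar>(exp \<rho> - 1) - (P * exp (- L) - 1)\<bar>"
      by (simp add: abs_mult)
    also have "\<dots> \<le> exp (real M * K) * ((C * exp C + Q) * u ^ (M + 1))"
      using 1 2 by (intro mult_mono L) (auto simp: distrib_right)
    finally have "\<bar>r\<bar> \<le> D * u ^ (M + 1)"
      by (simp add: D_def mult_ac)
    with eq show ?thesis
      unfolding pow_u P_def by blast
  qed
  show "\<exists>C. \<forall>\<^sub>F N in sequentially. \<forall>y\<in>admissible H {a..b} N. \<exists>r.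
          (case y of (h, p) \<Rightarrow> binom_prob N h p) = (case y of (h, p) \<Rightarrow> leading_factor N p) *
            ((\<Sum>n\<le>M. (case y of (h, p) \<Rightarrow> c_coeff n h p) / real N ^ n) + r)
          \<and> \<bar>r\<bar> \<le> C / real N ^ (M + 1)"
    using ev eventually_ge_at_top[of 1]
    by (intro exI[of _ D], eventually_elim) (use main in auto)
qed

text \<open>The event is a single integer, at which the floor is exact, and for positive bases
  \<open>powr\<close> with natural exponents is the ordinary power.\<close>

lemma binom_prob_eq_prob:
  assumes "0 < p" "p < 1" "real N * p + h \<in> real ` {0..N}"
  shows "binom_prob N h p = measure_pmf.prob (binomial_pmf N p) {j. real j = real N * p + h}"
proof -
  obtain j where j: "j \<le> N" "real N * p + h = real j"
    using assms(3) by auto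
  have "{i. real i = real N * p + h} = {j}"
    unfolding j(2) by auto
  moreover have "real N * (1 - p) - h = real (N - j)"
    using j by (simp add: of_nat_diff algebra_simps)
  ultimately show ?thesis
    using assms(1,2) by (simp add: binom_prob_def j(2) measure_pmf_single powr_realpow del: of_nat_diff)
qed

text \<open>At order \<open>M\<close> only coefficients with index at most \<open>M\<close> enter.
  There the re-expanded exponential has the coefficients \<open>c_coeff\<close>, so both forms
  express the same expansion.\<close>

lemma binom_prob_exp_and_series_expansion:
  assumes "compact H" "0 < a" "b < 1"
  shows "exp_series_expansion (\<lambda>N (h, p). binom_prob N h p) (\<lambda>N (h, p). leading_factor N p)
            (\<lambda>k (h, p). A_coeff k h p) (admissible H {a..b})
       \<and> series_expansion (\<lambda>N (h, p). binom_prob N h p) (\<lambda>N (h, p). leading_factor N p)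
            (\<lambda>m (h, p). c_coeff m h p) (admissible H {a..b})"
proof -
  have "fps_nth (fps_exp 1 oo (\<Sum>k = 1..M. fps_const (case y of (h, p) \<Rightarrow> A_coeff k h p) * fps_X ^ k)) n
        = (case y of (h, p) \<Rightarrow> c_coeff n h p)" if "n \<le> M" for M n and y :: "real \<times> real"
    using fps_exp_compose_nth[of "\<lambda>n. c_coeff n (fst y) (snd y)", OF _ c_coeff_rec that]
    by (simp add: case_prod_beta)
  thus ?thesis
    using binom_prob_expansion[OF assms]
    by (simp add: exp_series_expansion_def series_expansion_def uniform_expansion_def)
qed

theorem theorem3p1:
  fixes p :: real and H :: "real set"
  assumes "0 < p" and "p < 1" and "compact H"
  shows
    "(\<forall>N\<ge>1. \<forall>h\<in>H. real N * p + h \<in> real ` {0..N} \<longrightarrow>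
        binom_prob N h p = measure_pmf.prob (binomial_pmf N p) {j. real j = real N * p + h})
     \<and> exp_series_expansion
         (\<lambda>N (h, p). binom_prob N h p) (\<lambda>N (h, p). leading_factor N p)
         (\<lambda>k (h, p). A_coeff k h p) (admissible H {p})
     \<and> series_expansion
         (\<lambda>N (h, p). binom_prob N h p) (\<lambda>N (h, p). leading_factor N p)
         (\<lambda>m (h, p). c_coeff m h p) (admissible H {p})
     \<and> (\<forall>a b. 0 < a \<and> a \<le> b \<and> b < 1 \<longrightarrow>
          exp_series_expansion
            (\<lambda>N (h, p). binom_prob N h p) (\<lambda>N (h, p). leading_factor N p)
            (\<lambda>k (h, p). A_coeff k h p) (admissible H {a..b})
        \<and> series_expansion
            (\<lambda>N (h, p). binom_prob N h p) (\<lambda>N (h, p). leading_factor N p)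
            (\<lambda>m (h, p). c_coeff m h p) (admissible H {a..b}))"
  \<comment> \<open>A fixed \<open>p\<close> is the degenerate interval
    \<open>{p..p}\<close>.\<close>
  using binom_prob_eq_prob[OF assms(1,2)] binom_prob_exp_and_series_expansion[OF assms(3)]
    binom_prob_exp_and_series_expansion[OF assms(3), of p p] assms(1,2)
  by (intro conjI) auto

end
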